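(* Let $\ell_{in},\ell_{out},\ell$ be positive integers with $\ell\ge \ell_{in}$, $\ell\ge\ell_{out}$ and $\ell_{out}<\ell$, let $m=2^{\ell_{out}}$, and let $n\le 2^{\ell_{in}}$ satisfy $n<m$ and $m = O(n)$. For an $\ell$-bit multiplier $a$ define $h_a(x) = \lfloor (ax \bmod 2^\ell)/2^{\ell-\ell_{out}}\rfloor \in [m]$. If $a$ is a uniformly distributed odd $\ell$-bit number and $h_a$ is used to insert the keys $[n]=\{0,\dots,n-1\}$ into a linear probing table of size $m$, then the expected average insertion cost per key is $\Omega(\log n)$.
   Context: Linear probing: the table is an array of $m$ cells indexed cyclically by $[m]$; to insert $x$, the cells $h(x),h(x)+1,\dots$ (mod $m$) are scanned and $x$ is placed in the first empty cell; the insertion cost is the number of cells scanned. The average insertion cost is the total insertion cost divided by the number of keys. *)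

theory Defs
  imports "HOL-Probability.Probability"
begin

definition mult_shift :: "nat \<Rightarrow> nat \<Rightarrow> nat \<Rightarrow> nat \<Rightarrow> nat" where
  "mult_shift l l_out a x = ((a * x) mod 2 ^ l) div 2 ^ (l - l_out)"

definition odd_multipliers :: "nat \<Rightarrow> nat set" where
  "odd_multipliers l = {a. odd a \<and> a < 2 ^ l}"

text \<open>A table with \<open>m\<close> cells is a function of which only the arguments \<open>0, \<dots>, m - 1\<close> are
  used. \<open>LEAST\<close> is unspecified if there is no empty cell, which does not occur when fewer than
  \<open>m\<close> keys are inserted into an empty table.\<close>

type_synonym 'k lp_table = "nat \<Rightarrow> 'k option"

definition lp_offset :: "nat \<Rightarrow> ('k \<Rightarrow> nat) \<Rightarrow> 'k lp_table \<Rightarrow> 'k \<Rightarrow> nat" where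
  "lp_offset m h T x = (LEAST d. T ((h x + d) mod m) = None)"

definition lp_insert :: "nat \<Rightarrow> ('k \<Rightarrow> nat) \<Rightarrow> 'k lp_table \<Rightarrow> 'k \<Rightarrow> 'k lp_table" where
  "lp_insert m h T x = T((h x + lp_offset m h T x) mod m := Some x)"

text \<open>The empty cell that receives the key counts as scanned, so every insertion costs at
  least \<open>1\<close>.\<close>

definition lp_insert_cost :: "nat \<Rightarrow> ('k \<Rightarrow> nat) \<Rightarrow> 'k lp_table \<Rightarrow> 'k \<Rightarrow> nat" where
  "lp_insert_cost m h T x = lp_offset m h T x + 1"

fun lp_total_cost :: "nat \<Rightarrow> ('k \<Rightarrow> nat) \<Rightarrow> 'k lp_table \<Rightarrow> 'k list \<Rightarrow> nat" where
  "lp_total_cost m h T [] = 0"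
| "lp_total_cost m h T (x # xs) =
     lp_insert_cost m h T x + lp_total_cost m h (lp_insert m h T x) xs"

definition lp_average_cost :: "nat \<Rightarrow> ('k \<Rightarrow> nat) \<Rightarrow> 'k list \<Rightarrow> real" where
  "lp_average_cost m h xs = real (lp_total_cost m h (\<lambda>_. None) xs) / real (length xs)"

end

theory Submission
  imports Defs "HOL-Number_Theory.Cong"
begin

text \<open>Write \<open>L = 2^l\<close> and \<open>B = 2^(l - l_out)\<close>, so that \<open>L = m B\<close>. If \<open>\<delta> = a q mod L\<close> is at most
  \<open>B / 2\<close>, then each of the progressions \<open>r, r + q, r + 2q, \<dots>\<close> (with \<open>r < q\<close>) is hashed to a
  window with half as many cells as keys. As its keys end up in different cells, it pays
  quadratically in its length \<open>n div q\<close>, and the average cost is at least \<open>n / (16 q)\<close>. For each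
  odd \<open>q\<close>, a fraction of order \<open>1 / m\<close> of the multipliers has \<open>B / 4 \<le> a q mod L \<le> B / 2\<close>, so
  summing over \<open>q\<close> suggests \<open>(n / m) \<Sum> 1 / q\<close>. The events for different \<open>q\<close> overlap, but with
  \<open>q0\<close> the least \<open>q\<close> such that \<open>a q mod L \<le> B / 2\<close>, all the \<open>q\<close> counted for \<open>a\<close> are
  multiples \<open>g q0\<close> with \<open>g\<close> in an interval \<open>{g1..2 * g1}\<close>, so that \<open>\<Sum> 1 / q \<le> 2 / q0\<close>.\<close>

section \<open>The cost of linear probing\<close>

lemma lp_offset_empty:
  assumes "card {i. i < m \<and> T i \<noteq> None} < m"
  shows "T ((h x + lp_offset m h T x) mod m) = None"
proof -
  have "\<exists>i<m. T i = None"
  proof (rule ccontr)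
    assume "\<not> ?thesis"
    then have "{i. i < m \<and> T i \<noteq> None} = {..<m}" by auto
    then show False using assms by simp
  qed
  then obtain i where i: "i < m" "T i = None" by blast
  \<comment> \<open>Witness for an empty cell being reached: walk from \<open>h x mod m\<close> to
    the end of the array and then on to \<open>i\<close>. The subtraction is not truncated because
    \<open>h x mod m < m\<close>.\<close>
  have "(h x + (i + (m - h x mod m))) mod m = (h x mod m + (i + (m - h x mod m))) mod m"
    by (simp add: mod_add_left_eq)
  also have "h x mod m + (i + (m - h x mod m)) = i + m"
    using i mod_less_divisor[of m "h x"] by linarith
  also have "(i + m) mod m = i" using i by simp
  finally have "(h x + (i + (m - h x mod m))) mod m = i" .
  then have "\<exists>d. T ((h x + d) mod m) = None" using i by metis
  then show ?thesis unfolding lp_offset_def by (rule LeastI_ex)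
qed

text \<open>A placed key is never moved, so the whole run can be summarised by displacements with
  pairwise different final cells; insertion order then disappears from the lower bound. The third
  conjunct serves the induction: cells free in the table after inserting \<open>x\<close> differ
  from the cell taken by \<open>x\<close>.\<close>

lemma lp_total_cost_displacements:
  assumes "distinct xs" "card {i. i < m \<and> T i \<noteq> None} + length xs \<le> m"
  shows "\<exists>d. lp_total_cost m h T xs = (\<Sum>x\<in>set xs. d x + 1) \<and>
    inj_on (\<lambda>x. (h x + d x) mod m) (set xs) \<and>
    (\<forall>x\<in>set xs. T ((h x + d x) mod m) = None)"
  using assms
proof (induction xs arbitrary: T)
  case Nil
  then show ?case by simp
next
  case (Cons x xs)
  define o' where "o' = lp_offset m h T x"
  define p where "p = (h x + o') mod m"
  define T' where "T' = lp_insert m h T x"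
  have T': "T' = T(p := Some x)" unfolding T'_def lp_insert_def p_def o'_def by simp
  have m: "m > 0" using Cons.prems by simp
  have free: "T p = None"
    unfolding p_def o'_def by (rule lp_offset_empty) (use Cons.prems in simp)
  have "{i. i < m \<and> T' i \<noteq> None} = insert p {i. i < m \<and> T i \<noteq> None}"
    unfolding T' using m by (auto simp: p_def)
  then have "card {i. i < m \<and> T' i \<noteq> None} \<le> card {i. i < m \<and> T i \<noteq> None} + 1"
    by (simp add: card_insert_if)
  then have "card {i. i < m \<and> T' i \<noteq> None} + length xs \<le> m" using Cons.prems by simp
  from Cons.IH[OF _ this] Cons.prems obtain d where d:
    "lp_total_cost m h T' xs = (\<Sum>x\<in>set xs. d x + 1)"
    "inj_on (\<lambda>x. (h x + d x) mod m) (set xs)"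
    "\<forall>x\<in>set xs. T' ((h x + d x) mod m) = None" by auto
  define d' where "d' = d(x := o')"
  have x: "x \<notin> set xs" using Cons.prems by simp
  then have dd: "\<And>y. y \<in> set xs \<Longrightarrow> d' y = d y" by (auto simp: d'_def)
  have dx: "d' x = o'" by (simp add: d'_def)
  have ne: "(h y + d y) mod m \<noteq> p" if "y \<in> set xs" for y
    using d(3) that unfolding T' by (metis fun_upd_same option.distinct(1))
  have "lp_total_cost m h T (x # xs) = (\<Sum>x\<in>set (x # xs). d' x + 1)"
    using d(1) x dd dx by (simp add: lp_insert_cost_def flip: T'_def o'_def)
  moreover have "inj_on (\<lambda>x. (h x + d' x) mod m) (set (x # xs))"
  proof -
    have "inj_on (\<lambda>x. (h x + d' x) mod m) (set xs)"
      using d(2) dd by (simp add: inj_on_def)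
    moreover have "(h x + d' x) mod m \<notin> (\<lambda>x. (h x + d' x) mod m) ` set xs"
      using ne dd dx by (auto simp flip: p_def)
    ultimately show ?thesis using x by simp
  qed
  moreover have "\<forall>y\<in>set (x # xs). T ((h y + d' y) mod m) = None"
    using d(3) dd dx free ne by (auto simp: T' simp flip: p_def)
  ultimately show ?case by blast
qed

section \<open>Quadratic cost of keys hashed to a window of half their number\<close>

lemma sum_distinct_nats_ge:
  fixes f :: "nat \<Rightarrow> nat"
  assumes "inj_on f {..<k}"
  shows "\<Sum>{..<k} \<le> sum f {..<k}"
proof -
  have "\<Sum>{..<k} \<le> \<Sum>A" if "finite A" "card A = k" for A :: "nat set" and k
    using that
  proof (induction k arbitrary: A)
    case 0
    then show ?case by simp
  next
    case (Suc k)
    have ne: "A \<noteq> {}" using Suc.prems by auto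
    define M where "M = Max A"
    have M: "M \<in> A" using ne Suc.prems by (simp add: M_def)
    have "A \<subseteq> {..M}" using Suc.prems by (auto simp: M_def)
    then have "card A \<le> M + 1" using card_mono[of "{..M}" A] by simp
    \<comment> \<open>The largest of \<open>k + 1\<close> distinct naturals is at least
      \<open>k\<close>; removing it leaves a set for the induction hypothesis.\<close>
    then have "k \<le> M" using Suc.prems by simp
    moreover have "\<Sum>{..<k} \<le> \<Sum>(A - {M})"
      using Suc.IH[of "A - {M}"] Suc.prems M by simp
    moreover have "\<Sum>A = M + \<Sum>(A - {M})" using Suc.prems M by (simp add: sum.remove)
    ultimately show ?case by simp
  qed
  from this[of "f ` {..<k}" k] show ?thesis
    using assms by (simp add: card_image sum.reindex)
qed

text \<open>The final positions relative to \<open>s\<close> are distinct naturals, so they sum to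
  at least \<open>0 + ... + (k - 1)\<close>. The hash values advance only about \<open>i / 2\<close>
  at index \<open>i\<close>, so the displacements have to supply the other half. The
  \<open>+ 1\<close> in the upper bound on \<open>H\<close> absorbs rounding.\<close>

lemma progression_cost_ge:
  fixes H d :: "nat \<Rightarrow> nat"
  assumes inj: "inj_on (\<lambda>i. (H i + d i) mod m) {..<k}"
    and ge: "\<And>i. i < k \<Longrightarrow> s \<le> H i" and le: "\<And>i. i < k \<Longrightarrow> 2 * H i \<le> 2 * s + i + 1"
  shows "k\<^sup>2 \<le> 4 * (\<Sum>i<k. d i + 1)"
proof -
  define P where "P i = H i + d i - s" for i
  have "inj_on P {..<k}"
  proof (rule inj_onI)
    fix i j assume ij: "i \<in> {..<k}" "j \<in> {..<k}" "P i = P j"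
    then have "H i + d i = H j + d j" using ge[of i] ge[of j] unfolding P_def by simp
    then show "i = j" using inj ij by (auto simp: inj_on_def)
  qed
  then have 1: "\<Sum>{..<k} \<le> sum P {..<k}" by (rule sum_distinct_nats_ge)
  have "(\<Sum>i<k. 2 * P i + 1) \<le> (\<Sum>i<k. 2 * (d i + 1) + i)"
  proof (rule sum_mono)
    fix i assume "i \<in> {..<k}"
    then show "2 * P i + 1 \<le> 2 * (d i + 1) + i" using ge[of i] le[of i] unfolding P_def by simp
  qed
  then have 2: "2 * sum P {..<k} + k \<le> 2 * (\<Sum>i<k. d i + 1) + \<Sum>{..<k}"
    by (simp only: sum.distrib sum_distrib_left[symmetric]) simp
  have "2 * \<Sum>{..<k} + k = k\<^sup>2"
    by (induction k) (auto simp: power2_eq_square)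
  with 1 2 show ?thesis by linarith
qed

section \<open>Multipliers that map a short step to a short step\<close>

lemma mod_div_mult_nat: "(y mod (m * B)) div B = (y div B) mod (m::nat)" if "B > 0"
  using that by (simp add: mod_mult2_eq mult.commute[of m B])

text \<open>The \<open>q\<close> progressions of step \<open>q\<close> are disjoint, so their costs
  of at least \<open>(n div q)\<^sup>2 / 4\<close> each add up.\<close>

lemma lp_total_cost_mult_shift_ge:
  fixes a q n l l_out :: nat
  assumes lo: "l_out \<le> l" and n: "n < 2 ^ l_out" and q: "0 < q"
    and d: "2 * (a * q mod 2 ^ l) \<le> 2 ^ (l - l_out)"
    and xs: "distinct xs" "set xs = {0..<n}"
  shows "q * (n div q)\<^sup>2 \<le> 4 * lp_total_cost (2 ^ l_out) (mult_shift l l_out a) (\<lambda>_. None) xs"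
proof -
  define m :: nat where "m = 2 ^ l_out"
  define B :: nat where "B = 2 ^ (l - l_out)"
  define \<delta> where "\<delta> = a * q mod 2 ^ l"
  define k where "k = n div q"
  define h where "h = mult_shift l l_out a"
  have B: "B > 0" by (simp add: B_def)
  have L: "2 ^ l = m * B" using lo by (simp add: m_def B_def flip: power_add)
  have "length xs = n" using xs distinct_card by fastforce
  then have "card {i. i < m \<and> (\<lambda>_. None :: nat option) i \<noteq> None} + length xs \<le> m"
    using n by (simp add: m_def)
  from lp_total_cost_displacements[OF xs(1) this, of h] obtain D where D:
    "lp_total_cost m h (\<lambda>_. None) xs = (\<Sum>x\<in>{0..<n}. D x + 1)"
    "inj_on (\<lambda>x. (h x + D x) mod m) {0..<n}" using xs(2) by auto
  \<comment> \<open>Enumerates the first \<open>k * q\<close> keys by residue and index; the fewer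
    than \<open>q\<close> remaining keys are dropped from the count.\<close>
  define key where "key = (\<lambda>(r, i). r + i * q)"
  have kq: "k * q \<le> n" by (simp add: k_def)
  have key_lt: "r + i * q < n" if "r < q" "i < k" for r i
  proof -
    have "r + i * q < Suc i * q" using that by simp
    also have "\<dots> \<le> k * q" using that by (intro mult_right_mono) auto
    finally show ?thesis using kq by simp
  qed
  have inj_key: "inj_on key ({..<q} \<times> {..<k})"
  proof (rule inj_onI, clarify)
    fix r i r' i' assume *: "r < q" "r' < q" "key (r, i) = key (r', i')"
    then have "(r + i * q) mod q = (r' + i' * q) mod q" "(r + i * q) div q = (r' + i' * q) div q"
      by (simp_all add: key_def)
    then show "r = r' \<and> i = i'" using * by simp
  qed
  have chain: "k\<^sup>2 \<le> 4 * (\<Sum>i<k. D (r + i * q) + 1)" if r: "r < q" for r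
  proof -
    define u where "u = a * r mod 2 ^ l"
    \<comment> \<open>The hash value before reduction modulo \<open>m\<close>: it does not wrap
      around, so it can be compared with the start \<open>u div B\<close> of the window.\<close>
    define H where "H i = (u + i * \<delta>) div B" for i
    have h: "h (r + i * q) = H i mod m" for i
    proof -
      have "a * (r + i * q) mod 2 ^ l = (a * r + i * (a * q)) mod 2 ^ l"
        by (simp add: algebra_simps)
      also have "\<dots> = (u + i * \<delta>) mod 2 ^ l"
        unfolding u_def \<delta>_def by (intro mod_add_cong mod_mult_cong) simp_all
      finally show ?thesis
        unfolding h_def mult_shift_def H_def B_def[symmetric] L
        using mod_div_mult_nat[OF B] by simp
    qed
    show ?thesis
    proof (rule progression_cost_ge[where H = H and m = m and s = "u div B"])
      show "inj_on (\<lambda>i. (H i + D (r + i * q)) mod m) {..<k}"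
      proof (rule inj_onI)
        fix i j assume ij: "i \<in> {..<k}" "j \<in> {..<k}"
          "(H i + D (r + i * q)) mod m = (H j + D (r + j * q)) mod m"
        then have "(h (r + i * q) + D (r + i * q)) mod m = (h (r + j * q) + D (r + j * q)) mod m"
          by (simp add: h mod_add_left_eq)
        then have "r + i * q = r + j * q"
          using D(2) key_lt[OF r] ij(1,2) by (auto dest: inj_onD)
        then show "i = j" using q by simp
      qed
    next
      fix i assume "i < k"
      show "u div B \<le> H i" unfolding H_def by (intro div_le_mono) simp
      have "H i * B \<le> u + i * \<delta>" by (simp add: H_def)
      moreover have "2 * (i * \<delta>) \<le> i * B"
        using mult_left_mono[OF d, of i] unfolding \<delta>_def B_def by (simp add: mult.left_commute)
      \<comment> \<open>Strictness here turns the rounding loss of \<open>2 * B\<close> into the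
        additive \<open>1\<close> required below.\<close>
      moreover have "u < u div B * B + B"
        using B dividend_less_div_times[of B u] by simp
      ultimately have "2 * (H i * B) < 2 * (u div B * B) + 2 * B + i * B" by linarith
      then have "(2 * H i) * B < (2 * (u div B) + 2 + i) * B"
        by (simp only: distrib_right mult.assoc)
      then have "2 * H i < 2 * (u div B) + 2 + i" by (simp only: mult_less_cancel2)
      then show "2 * H i \<le> 2 * (u div B) + i + 1" by simp
    qed
  qed
  have "q * k\<^sup>2 = (\<Sum>r<q. k\<^sup>2)" by simp
  also have "\<dots> \<le> (\<Sum>r<q. 4 * (\<Sum>i<k. D (r + i * q) + 1))"
    by (rule sum_mono) (use chain in simp)
  also have "\<dots> = 4 * (\<Sum>(r, i)\<in>{..<q} \<times> {..<k}. D (r + i * q) + 1)"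
    by (simp only: sum_distrib_left sum.cartesian_product case_prod_unfold)
  also have "(\<Sum>(r, i)\<in>{..<q} \<times> {..<k}. D (r + i * q) + 1) = (\<Sum>x\<in>key ` ({..<q} \<times> {..<k}). D x + 1)"
    by (subst sum.reindex[OF inj_key]) (simp add: key_def case_prod_unfold)
  also have "4 * \<dots> \<le> 4 * (\<Sum>x\<in>{0..<n}. D x + 1)"
    by (intro mult_left_mono sum_mono2) (auto simp: key_def key_lt)
  finally show ?thesis using D(1) unfolding k_def m_def h_def by simp
qed

text \<open>As \<open>q \<le> n\<close>, rounding \<open>n / q\<close> down loses at most a factor
  2, hence 4 after squaring; together with the 4 in the total cost bound this gives 16.\<close>

lemma lp_average_cost_mult_shift_ge:
  fixes a q n l l_out :: nat
  assumes lo: "l_out \<le> l" and n: "n < 2 ^ l_out" and q: "0 < q" "q \<le> n"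
    and d: "2 * (a * q mod 2 ^ l) \<le> 2 ^ (l - l_out)"
    and xs: "distinct xs" "set xs = {0..<n}"
  shows "lp_average_cost (2 ^ l_out) (mult_shift l l_out a) xs \<ge> real n / (16 * real q)"
proof -
  define k where "k = n div q"
  have len: "length xs = n" using xs distinct_card by fastforce
  define t where "t = lp_total_cost (2 ^ l_out) (mult_shift l l_out a) (\<lambda>_. None) xs"
  have "q * k\<^sup>2 \<le> 4 * t"
    unfolding k_def t_def by (rule lp_total_cost_mult_shift_ge) (use assms in auto)
  then have t: "real q * (real k)\<^sup>2 \<le> 4 * real t"
    by (metis of_nat_le_iff of_nat_mult of_nat_numeral of_nat_power)
  have "k \<ge> 1" using q unfolding k_def by (simp add: Suc_leI div_greater_zero_iff)
  moreover have "n < (k + 1) * q"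
    using q dividend_less_times_div[of q n] by (simp add: k_def algebra_simps)
  moreover have "(k + 1) * q \<le> 2 * k * q" using \<open>k \<ge> 1\<close> by (intro mult_le_mono1) simp
  ultimately have "n \<le> 2 * k * q" by linarith
  then have "real n \<le> 2 * real k * real q"
    by (metis of_nat_le_iff of_nat_mult of_nat_numeral)
  then have "(real n)\<^sup>2 \<le> (2 * real k * real q)\<^sup>2" by (intro power_mono) auto
  also have "\<dots> = 4 * real q * (real q * (real k)\<^sup>2)" by (simp add: power2_eq_square)
  also have "\<dots> \<le> 4 * real q * (4 * real t)" using t by (intro mult_left_mono) auto
  finally have "real n * real n \<le> 16 * real q * real t" by (simp add: power2_eq_square)
  then show ?thesis
    using q unfolding lp_average_cost_def len t_def[symmetric] by (simp add: field_simps)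
qed

section \<open>Summing reciprocals over the steps counted for one multiplier\<close>

definition mid_odds :: "nat \<Rightarrow> nat set" where
  "mid_odds B = {\<delta>. odd \<delta> \<and> B \<le> 4 * \<delta> \<and> 2 * \<delta> \<le> B}"

lemma finite_mid_odds: "finite (mid_odds B)"
  by (rule finite_subset[of _ "{..B}"]) (auto simp: mid_odds_def)

lemma card_mid_odds_ge:
  assumes "j > 0"
  shows "2 ^ j \<le> 8 * card (mid_odds (2 ^ j))"
proof (cases "j \<ge> 3")
  case True
  define b :: nat where "b = 2 ^ (j - 3)"
  have B: "2 ^ j = 8 * b"
    using True power_add[of "2::nat" 3 "j - 3"] by (simp add: b_def)
  \<comment> \<open>The interval from \<open>2 * b\<close> to \<open>4 * b\<close> contains the
    \<open>b\<close> odd numbers listed here.\<close>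
  have "(\<lambda>i. 2 * b + 1 + 2 * i) ` {..<b} \<subseteq> mid_odds (8 * b)"
    by (auto simp: mid_odds_def)
  moreover have "inj_on (\<lambda>i. 2 * b + 1 + 2 * i) {..<b}" by (auto simp: inj_on_def)
  ultimately have "b \<le> card (mid_odds (8 * b))"
    using card_mono[OF finite_mid_odds] by (metis card_image card_lessThan)
  then show ?thesis by (simp add: B)
next
  case False
  \<comment> \<open>Here \<open>1\<close> is a member, while for \<open>j = 0\<close> the set would
    be empty; this is where \<open>l_out < l\<close> matters.\<close>
  then have "j = 1 \<or> j = 2" using assms by auto
  then have "{1} \<subseteq> mid_odds (2 ^ j)" "(2::nat) ^ j \<le> 8" by (auto simp: mid_odds_def)
  then show ?thesis using card_mono[OF finite_mid_odds, of "{1}" "2 ^ j"] by simp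
qed

text \<open>Odd \<open>q\<close> are units modulo a power of two, so multiplication by
  \<open>q\<close> permutes the odd residues. This fits the odd targets in \<open>mid_odds\<close>
  and makes counting the multipliers for a given \<open>q\<close> easy.\<close>

definition good_steps :: "nat \<Rightarrow> nat \<Rightarrow> nat \<Rightarrow> nat \<Rightarrow> nat set" where
  "good_steps L B n a = {q. odd q \<and> q \<le> n \<and> a * q mod L \<in> mid_odds B}"

lemma finite_good_steps: "finite (good_steps L B n a)"
  by (rule finite_subset[of _ "{..n}"]) (auto simp: good_steps_def)

text \<open>Products of a step up to \<open>n\<close> and a short residue stay below
  \<open>n * B < L\<close>, so congruences between them are equalities. This forces \<open>q\<close>
  and its residue to be the same multiple of \<open>q0\<close> and its residue. Residues between
  \<open>B / 4\<close> and \<open>B / 2\<close> then confine the factors to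
  \<open>{g1..2 * g1}\<close>.\<close>

lemma sum_good_steps_le:
  assumes L: "L = m * B" and n: "n < m" and ne: "good_steps L B n a \<noteq> {}"
  obtains q0 where "0 < q0" "q0 \<le> n" "2 * (a * q0 mod L) \<le> B"
    "(\<Sum>q\<in>good_steps L B n a. 1 / real q) \<le> 2 / real q0"
proof -
  define S where "S = good_steps L B n a"
  define \<delta> where "\<delta> q = a * q mod L" for q
  define P where "P q \<longleftrightarrow> 0 < q \<and> 2 * \<delta> q \<le> B" for q
  define q0 where "q0 = (LEAST q. P q)"
  have S: "P q" "q \<le> n" "B \<le> 4 * \<delta> q" "0 < \<delta> q" if "q \<in> S" for q
    using that unfolding S_def good_steps_def mid_odds_def P_def \<delta>_def
    by (auto intro: odd_pos)
  obtain q' where q': "q' \<in> S" using ne unfolding S_def by blast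
  have P0: "P q0" unfolding q0_def using S(1)[OF q'] by (rule LeastI)
  have min: "q0 \<le> q" if "P q" for q unfolding q0_def using that by (rule Least_le)
  have "q0 \<le> n" using min[OF S(1)[OF q']] S(2)[OF q'] by simp
  have q0: "0 < q0" "2 * \<delta> q0 \<le> B" using P0 by (auto simp: P_def)
  have small: "q * \<delta> r < L" if "q \<le> n" "P r" "0 < B" for q r
  proof -
    have "q * \<delta> r \<le> n * B" using that by (intro mult_le_mono) (auto simp: P_def)
    also have "\<dots> < L" using n that L by simp
    finally show ?thesis .
  qed
  have mult: "\<exists>g. q = g * q0 \<and> \<delta> q = g * \<delta> q0" if q: "q \<in> S" for q
  proof -
    have B: "0 < B" using S[OF q] by (auto simp: P_def)
    have "q * \<delta> q0 mod L = q0 * \<delta> q mod L"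
      unfolding \<delta>_def by (metis mod_mult_right_eq mult.assoc mult.commute)
    then have eq: "q * \<delta> q0 = q0 * \<delta> q"
      using small[OF S(2)[OF q] P0 B] small[OF \<open>q0 \<le> n\<close> S(1)[OF q] B] by simp
    define g where "g = q div q0"
    define r where "r = q mod q0"
    have qgr: "q = g * q0 + r" by (simp add: g_def r_def)
    \<comment> \<open>Ensures that the subtraction \<open>\<delta> q - g * \<delta> q0\<close> below
      is not truncated.\<close>
    have "q0 * (g * \<delta> q0) \<le> q * \<delta> q0" unfolding qgr by (simp add: algebra_simps)
    then have le: "g * \<delta> q0 \<le> \<delta> q" using eq q0 by simp
    have "\<delta> q = (g * \<delta> q0 + a * r) mod L"
    proof -
      have "\<delta> q = (g * (a * q0) + a * r) mod L" unfolding \<delta>_def by (subst qgr) (simp add: algebra_simps)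
      also have "\<dots> = (g * \<delta> q0 + a * r) mod L"
        unfolding \<delta>_def by (metis mod_add_left_eq mod_mult_right_eq)
      finally show ?thesis .
    qed
    moreover have "\<delta> q < L" using small[of 1 q] S[OF q] B by (simp add: P_def)
    ultimately have "[g * \<delta> q0 + a * r = g * \<delta> q0 + (\<delta> q - g * \<delta> q0)] (mod L)"
      using le by (simp add: cong_def)
    then have "[a * r = \<delta> q - g * \<delta> q0] (mod L)" by (simp add: cong_add_lcancel_nat)
    then have dr: "\<delta> r = \<delta> q - g * \<delta> q0"
      using \<open>\<delta> q < L\<close> unfolding cong_def \<delta>_def[of r] by simp
    \<comment> \<open>A nonzero remainder \<open>r < q0\<close> would have a residue of at most
      \<open>\<delta> q\<close>, so it would be a short step below the least one.\<close>
    have "r = 0"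
    proof (rule ccontr)
      assume "r \<noteq> 0"
      then have "P r" using S(1)[OF q] dr by (auto simp: P_def)
      then have "q0 \<le> r" by (rule min)
      moreover have "r < q0" using q0 by (simp add: r_def)
      ultimately show False by simp
    qed
    moreover have "\<delta> 0 = 0" by (simp add: \<delta>_def)
    ultimately show ?thesis using qgr dr le by auto
  qed
  define q1 where "q1 = Min S"
  have fin: "finite S" unfolding S_def by (rule finite_good_steps)
  have q1: "q1 \<in> S" using fin q' unfolding q1_def by (metis Min_in empty_iff)
  obtain g1 where g1: "q1 = g1 * q0" "\<delta> q1 = g1 * \<delta> q0" using mult[OF q1] by blast
  have "0 < g1" "0 < \<delta> q0" using S(4)[OF q1] g1 by auto
  have sub: "S \<subseteq> (\<lambda>g. g * q0) ` {g1..2 * g1}"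
  proof
    fix q assume q: "q \<in> S"
    obtain g where g: "q = g * q0" "\<delta> q = g * \<delta> q0" using mult[OF q] by blast
    have "q1 \<le> q" using fin q by (simp add: q1_def)
    then have "g1 \<le> g" using g g1 q0 by simp
    moreover have "2 * (g * \<delta> q0) \<le> B" "B \<le> 4 * (g1 * \<delta> q0)"
      using S(1)[OF q] S(3)[OF q1] by (simp_all add: P_def flip: g(2) g1(2))
    then have "g * \<delta> q0 \<le> (2 * g1) * \<delta> q0" unfolding mult.assoc by linarith
    then have "g \<le> 2 * g1" using \<open>0 < \<delta> q0\<close> by simp
    ultimately show "q \<in> (\<lambda>g. g * q0) ` {g1..2 * g1}" using g by auto
  qed
  have inj: "inj_on (\<lambda>g. g * q0) {g1..2 * g1}" using q0 by (auto simp: inj_on_def)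
  have "(\<Sum>q\<in>S. 1 / real q) \<le> (\<Sum>q\<in>(\<lambda>g. g * q0) ` {g1..2 * g1}. 1 / real q)"
    by (rule sum_mono2[OF _ sub]) auto
  also have "\<dots> = (\<Sum>g\<in>{g1..2 * g1}. 1 / real (g * q0))"
    by (simp add: sum.reindex[OF inj])
  \<comment> \<open>There are \<open>g1 + 1 \<le> 2 * g1\<close> terms, each at most
    \<open>1 / (g1 * q0)\<close>.\<close>
  also have "\<dots> \<le> (\<Sum>g\<in>{g1..2 * g1}. 1 / real (g1 * q0))"
    using \<open>0 < g1\<close> q0 by (intro sum_mono divide_left_mono) auto
  also have "\<dots> = (real g1 + 1) / (real g1 * real q0)" by simp
  also have "\<dots> \<le> 2 / real q0" using \<open>0 < g1\<close> q0 by (simp add: field_simps)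
  finally show thesis
    using that[of q0] q0 \<open>q0 \<le> n\<close> unfolding S_def \<delta>_def by blast
qed

text \<open>Trades the bound at the single step \<open>q0\<close>, which depends on \<open>a\<close>
  in a complicated way, for a sum that can be averaged over \<open>a\<close> by exchanging
  summations. The price is a factor 2, whence 32.\<close>

lemma lp_average_cost_ge_sum_good_steps:
  assumes "l_out \<le> l" "n < 2 ^ l_out" and xs: "distinct xs" "set xs = {0..<n}"
  shows "real n / 32 * (\<Sum>q\<in>good_steps (2 ^ l) (2 ^ (l - l_out)) n a. 1 / real q)
    \<le> lp_average_cost (2 ^ l_out) (mult_shift l l_out a) xs"
proof (cases "good_steps (2 ^ l) (2 ^ (l - l_out)) n a = {}")
  case True
  then show ?thesis by (simp add: lp_average_cost_def)
next
  case False
  have L: "(2::nat) ^ l = 2 ^ l_out * 2 ^ (l - l_out)" using assms by (simp flip: power_add)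
  obtain q0 where q0: "0 < q0" "q0 \<le> n" "2 * (a * q0 mod 2 ^ l) \<le> 2 ^ (l - l_out)"
    "(\<Sum>q\<in>good_steps (2 ^ l) (2 ^ (l - l_out)) n a. 1 / real q) \<le> 2 / real q0"
    using sum_good_steps_le[OF L assms(2) False] by blast
  have "real n / 32 * (\<Sum>q\<in>good_steps (2 ^ l) (2 ^ (l - l_out)) n a. 1 / real q)
    \<le> real n / 32 * (2 / real q0)"
    using q0(4) by (intro mult_left_mono) auto
  also have "\<dots> = real n / (16 * real q0)" by simp
  also have "\<dots> \<le> lp_average_cost (2 ^ l_out) (mult_shift l l_out a) xs"
    by (rule lp_average_cost_mult_shift_ge) (use assms q0 in auto)
  finally show ?thesis .
qed

section \<open>Averaging over the multipliers\<close>

lemma odd_multipliers_eq: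
  assumes "l > 0"
  shows "odd_multipliers l = (\<lambda>i. 2 * i + 1) ` {..<2 ^ (l - 1)}"
proof -
  have L: "(2::nat) ^ l = 2 * 2 ^ (l - 1)" using assms by (cases l) auto
  show ?thesis
    unfolding odd_multipliers_def L by (auto elim!: oddE)
qed

lemma card_odd_multipliers:
  assumes "l > 0"
  shows "card (odd_multipliers l) = 2 ^ (l - 1)"
  unfolding odd_multipliers_eq[OF assms] by (subst card_image) (auto simp: inj_on_def)

lemma finite_odd_multipliers: "finite (odd_multipliers l)"
  by (rule finite_subset[of _ "{..<2 ^ l}"]) (auto simp: odd_multipliers_def)

text \<open>Multiplication by an inverse of \<open>q\<close> modulo \<open>2 ^ l\<close> maps
  \<open>D\<close> injectively into the set of multipliers.\<close>

lemma card_odd_multipliers_preimage_ge: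
  fixes q :: nat
  assumes l: "l > 0" and q: "odd q" and D: "D \<subseteq> odd_multipliers l"
  shows "card D \<le> card {a \<in> odd_multipliers l. a * q mod 2 ^ l \<in> D}"
proof -
  have "coprime q (2 ^ l)" using q by simp
  then obtain y where y: "[q * y = 1] (mod 2 ^ l)"
    using cong_solve_coprime_nat by (metis One_nat_def)
  define f where "f \<delta> = y * \<delta> mod 2 ^ l" for \<delta>
  have f: "f \<delta> * q mod 2 ^ l = \<delta>" if "\<delta> \<in> D" for \<delta>
  proof -
    have "f \<delta> * q mod 2 ^ l = (q * y) * \<delta> mod 2 ^ l"
      unfolding f_def by (metis mod_mult_left_eq mult.assoc mult.commute)
    also have "\<dots> = \<delta> mod 2 ^ l"
      using y unfolding cong_def by (metis mod_mult_left_eq mult_1)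
    also have "\<dots> = \<delta>" using that D by (auto simp: odd_multipliers_def)
    finally show ?thesis .
  qed
  have "inj_on f D" using f by (metis inj_onI)
  moreover have "f ` D \<subseteq> {a \<in> odd_multipliers l. a * q mod 2 ^ l \<in> D}"
  proof clarify
    fix \<delta> assume \<delta>: "\<delta> \<in> D"
    have "odd \<delta>" using \<delta> D by (auto simp: odd_multipliers_def)
    \<comment> \<open>Reduction modulo \<open>2 ^ l\<close> preserves parity because
      \<open>l > 0\<close>.\<close>
    moreover have "even (f \<delta> * q mod 2 ^ l) \<longleftrightarrow> even (f \<delta> * q)"
      using l by (intro dvd_mod_iff) simp
    ultimately have "odd (f \<delta>)" using f[OF \<delta>] by auto
    moreover have "f \<delta> < 2 ^ l" by (simp add: f_def)
    ultimately show "f \<delta> \<in> odd_multipliers l \<and> f \<delta> * q mod 2 ^ l \<in> D"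
      using f[OF \<delta>] \<delta> by (simp add: odd_multipliers_def)
  qed
  ultimately show ?thesis
    using finite_odd_multipliers by (intro card_inj_on_le) auto
qed

text \<open>Pairing each even \<open>x\<close> with \<open>x - 1\<close> shows that the odd terms
  make up at least half of the harmonic sum.\<close>

lemma sum_odd_reciprocals_ge:
  assumes "n > 0"
  shows "ln (real n) / 2 \<le> (\<Sum>q | odd q \<and> q \<le> n. 1 / real q)"
proof -
  have "harm n \<le> 2 * (\<Sum>q | odd q \<and> q \<le> n. 1 / real q)"
  proof -
    have fin: "finite {q. P q \<and> q \<le> n}" for P by (rule finite_subset[of _ "{..n}"]) auto
    have split: "{1..n} = {q. odd q \<and> q \<le> n} \<union> {q. (even q \<and> 0 < q) \<and> q \<le> n}"
      by (auto simp: Suc_le_eq odd_pos)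
    have "harm n = (\<Sum>q | odd q \<and> q \<le> n. 1 / real q)
        + (\<Sum>q | (even q \<and> 0 < q) \<and> q \<le> n. 1 / real q)"
      unfolding harm_def split inverse_eq_divide
      by (rule sum.union_disjoint) (use fin in auto)
    also have "(\<Sum>q | (even q \<and> 0 < q) \<and> q \<le> n. 1 / real q) \<le> (\<Sum>q | odd q \<and> q \<le> n. 1 / real q)"
    proof (rule sum_le_included[where i = Suc])
      show "\<forall>x\<in>{q. (even q \<and> 0 < q) \<and> q \<le> n}. \<exists>y\<in>{q. odd q \<and> q \<le> n}.
          Suc y = x \<and> 1 / real x \<le> 1 / real y"
      proof clarify
        fix x assume x: "even x" "0 < x" "x \<le> n"
        then have "2 \<le> x" by (cases "x = 1") auto
        with x show "\<exists>y\<in>{q. odd q \<and> q \<le> n}. Suc y = x \<and> 1 / real x \<le> 1 / real y"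
          by (intro bexI[of _ "x - 1"]) (auto simp: field_simps)
      qed
    qed (use fin in auto)
    finally show ?thesis by simp
  qed
  moreover have "ln (real n) \<le> harm n"
    using assms ln_le_harm[of n] ln_le_cancel_iff[of "real n" "real n + 1"] by linarith
  ultimately show ?thesis by simp
qed

text \<open>Double counting: every odd \<open>q \<le> n\<close> is a good step for at least
  \<open>B / 8\<close> multipliers, and the odd reciprocals contribute
  \<open>ln n / 2\<close>.\<close>

lemma sum_good_steps_ge:
  assumes l: "l > 0" and lo: "l_out < l" and n: "n > 0"
  shows "real (2 ^ (l - l_out)) / 16 * ln (real n)
    \<le> (\<Sum>a\<in>odd_multipliers l. \<Sum>q\<in>good_steps (2 ^ l) (2 ^ (l - l_out)) n a. 1 / real q)"
proof -
  define B :: nat where "B = 2 ^ (l - l_out)"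
  define D where "D = mid_odds B"
  define Q where "Q = {q. odd q \<and> q \<le> n}"
  have Q: "finite Q" unfolding Q_def by (rule finite_subset[of _ "{..n}"]) auto
  have "B \<le> 2 ^ l" unfolding B_def by (rule power_increasing) auto
  then have D: "D \<subseteq> odd_multipliers l"
    unfolding D_def mid_odds_def odd_multipliers_def by (auto dest: odd_pos)
  have "B \<le> 8 * card D" unfolding B_def D_def by (rule card_mid_odds_ge) (use lo in simp)
  then have cD: "real B / 8 \<le> real (card D)" by simp
  have "real B / 16 * ln (real n) = real B / 8 * (ln (real n) / 2)" by simp
  also have "\<dots> \<le> real B / 8 * (\<Sum>q\<in>Q. 1 / real q)"
    using sum_odd_reciprocals_ge[OF n] unfolding Q_def by (intro mult_left_mono) auto
  also have "\<dots> = (\<Sum>q\<in>Q. real B / 8 * (1 / real q))" by (rule sum_distrib_left)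
  also have "\<dots> \<le> (\<Sum>q\<in>Q. \<Sum>a | a \<in> odd_multipliers l \<and> a * q mod 2 ^ l \<in> D. 1 / real q)"
  proof (rule sum_mono)
    fix q assume "q \<in> Q"
    then have "card D \<le> card {a \<in> odd_multipliers l. a * q mod 2 ^ l \<in> D}"
      using D l by (intro card_odd_multipliers_preimage_ge) (auto simp: Q_def)
    then have "real B / 8 \<le> real (card {a \<in> odd_multipliers l. a * q mod 2 ^ l \<in> D})"
      using cD by linarith
    then have "real B / 8 * (1 / real q)
        \<le> real (card {a \<in> odd_multipliers l. a * q mod 2 ^ l \<in> D}) * (1 / real q)"
      by (rule mult_right_mono) simp
    then show "real B / 8 * (1 / real q)
        \<le> (\<Sum>a | a \<in> odd_multipliers l \<and> a * q mod 2 ^ l \<in> D. 1 / real q)" by simp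
  qed
  also have "\<dots> = (\<Sum>a\<in>odd_multipliers l. \<Sum>q | q \<in> Q \<and> a * q mod 2 ^ l \<in> D. 1 / real q)"
    by (rule sum.swap_restrict[OF Q finite_odd_multipliers])
  also have "\<dots> = (\<Sum>a\<in>odd_multipliers l. \<Sum>q\<in>good_steps (2 ^ l) B n a. 1 / real q)"
    unfolding good_steps_def Q_def D_def by (simp add: conj_assoc)
  finally show ?thesis unfolding B_def .
qed

section \<open>The expected average cost and its constants\<close>

theorem theorem1:
  fixes C :: real
  shows "\<exists>c > (0::real). \<exists>n0 :: nat.
    \<forall>(l_in :: nat) (l_out :: nat) (l :: nat) (m :: nat) (n :: nat) (xs :: nat list).
      l_in > 0 \<longrightarrow> l_out > 0 \<longrightarrow> l > 0 \<longrightarrow>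
      l \<ge> l_in \<longrightarrow> l \<ge> l_out \<longrightarrow> l_out < l \<longrightarrow>
      m = 2 ^ l_out \<longrightarrow> n \<le> 2 ^ l_in \<longrightarrow> n < m \<longrightarrow>
      real m \<le> C * real n \<longrightarrow> n \<ge> n0 \<longrightarrow>
      distinct xs \<longrightarrow> set xs = {0..<n} \<longrightarrow>
      measure_pmf.expectation (pmf_of_set (odd_multipliers l))
        (\<lambda>a. lp_average_cost m (mult_shift l l_out a) xs)
      \<ge> c * log 2 (real n)"
proof (intro exI[of _ "ln 2 / (256 * max C 1)"] exI[of _ "1::nat"] conjI allI impI)
  \<comment> \<open>The 256 is \<open>32 * 16\<close> halved, since there are
    \<open>m * B / 2\<close> multipliers; \<open>ln 2\<close> converts the logarithm, and
    \<open>max C 1\<close> keeps the constant positive for every real \<open>C\<close>. The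
    threshold \<open>n \<ge> 1\<close> makes \<open>ln n\<close> nonnegative.\<close>
  show "0 < ln 2 / (256 * max C 1)" by (intro divide_pos_pos) auto
next
  fix l_in l_out l m n :: nat and xs :: "nat list"
  assume l: "l > 0" and lo: "l_out < l" and m: "m = 2 ^ l_out" and nm: "n < m"
    and C: "real m \<le> C * real n" and n: "n \<ge> 1" and xs: "distinct xs" "set xs = {0..<n}"
  define B :: nat where "B = 2 ^ (l - l_out)"
  define cost where "cost a = lp_average_cost m (mult_shift l l_out a) xs" for a
  define A where "A = odd_multipliers l"
  have B: "B > 0" by (simp add: B_def)
  have mpos: "m > 0" using nm by simp
  have "(2::nat) ^ l = m * B" using lo by (simp add: m B_def flip: power_add)
  moreover have "(2::nat) ^ l = 2 * 2 ^ (l - 1)" using l by (cases l) auto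
  ultimately have "2 * card A = m * B" using l by (simp add: A_def card_odd_multipliers)
  then have cA: "2 * real (card A) = real m * real B"
    by (metis of_nat_mult of_nat_numeral)
  have A: "finite A" "card A > 0"
    unfolding A_def using finite_odd_multipliers l by (auto simp: card_odd_multipliers)
  have "real n / 32 * (real B / 16 * ln (real n))
      \<le> real n / 32 * (\<Sum>a\<in>A. \<Sum>q\<in>good_steps (2 ^ l) B n a. 1 / real q)"
    using sum_good_steps_ge[OF l lo, of n] n unfolding A_def B_def by (intro mult_left_mono) auto
  also have "\<dots> = (\<Sum>a\<in>A. real n / 32 * (\<Sum>q\<in>good_steps (2 ^ l) B n a. 1 / real q))"
    by (rule sum_distrib_left)
  also have "\<dots> \<le> sum cost A"
    unfolding cost_def m B_def using lo nm xs
    by (intro sum_mono lp_average_cost_ge_sum_good_steps) (auto simp: m)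
  finally have "real n * real B * ln (real n) / 512 \<le> sum cost A" by simp
  then have "real n * real B * ln (real n) / 512 / real (card A) \<le> sum cost A / real (card A)"
    by (rule divide_right_mono) simp
  moreover have "real n * real B * ln (real n) / 512 / real (card A)
      = ln (real n) / 256 * (real n / real m)"
    using cA B mpos A by (simp add: field_simps)
  \<comment> \<open>The assumption \<open>m \<le> C * n\<close> enters here, bounding the load
    \<open>n / m\<close> from below.\<close>
  moreover have "ln (real n) / 256 * (1 / max C 1) \<le> ln (real n) / 256 * (real n / real m)"
  proof (rule mult_left_mono)
    have "C * real n \<le> max C 1 * real n" by (intro mult_right_mono) auto
    then have "real m \<le> max C 1 * real n" using C by linarith
    moreover have "max C 1 > 0" by simp
    ultimately show "1 / max C 1 \<le> real n / real m"
      using mpos by (simp add: divide_simps mult.commute)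
  qed (use n in auto)
  moreover have "ln 2 / (256 * max C 1) * log 2 (real n) = ln (real n) / 256 * (1 / max C 1)"
    by (simp add: log_def)
  moreover have "measure_pmf.expectation (pmf_of_set A) cost = sum cost A / real (card A)"
    using A by (intro integral_pmf_of_set) auto
  ultimately show "ln 2 / (256 * max C 1) * log 2 (real n)
      \<le> measure_pmf.expectation (pmf_of_set (odd_multipliers l))
        (\<lambda>a. lp_average_cost m (mult_shift l l_out a) xs)"
    unfolding A_def cost_def by linarith
qed

end
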